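(* Let $\delta\in\mathbb{C}$ and let $(N_1,\cdot_1,\circ_1)$ and $(N_2,\cdot_2,\circ_2)$ be two $\delta$-Novikov--Poisson algebras over $\mathbb{C}$. Define bilinear operations on $N_1\otimes N_2$ by $$(x_1\otimes x_2)\cdot(y_1\otimes y_2)=(x_1\cdot_1y_1)\otimes(x_2\cdot_2y_2),$$ $$(x_1\otimes x_2)\circ(y_1\otimes y_2)=(x_1\circ_1y_1)\otimes(x_2\cdot_2y_2)+(x_1\cdot_1y_1)\otimes(x_2\circ_2y_2),$$ where $x_1,y_1\in N_1$ and $x_2,y_2\in N_2$. Then $(N_1\otimes N_2,\cdot,\circ)$ is a $\delta$-Novikov--Poisson algebra.
   Context: A (left) $\delta$-Novikov algebra is an algebra $(N,\circ)$ satisfying $\delta(x\circ y)\circ z-x\circ(y\circ z)=\delta(y\circ x)\circ z-y\circ(x\circ z)$ and $(x\circ y)\circ z=(x\circ z)\circ y$. A $\delta$-Novikov--Poisson algebra is a vector space $N$ with two bilinear operations $\cdot$ (also written by juxtaposition) and $\circ$ such that $(N,\cdot)$ is a commutative associative algebra, $(N,\circ)$ is a $\delta$-Novikov algebra, and for all $x,y,z\in N$: $(xy)\circ z=x(y\circ z)$ and $\delta(x\circ y)z-x\circ(yz)=\delta(y\circ x)z-y\circ(xz)$. *)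

theory Defs
  imports Complex_Main "HOL-Library.Poly_Mapping"
begin

class complex_vector = ab_group_add +
  fixes scaleC :: "complex \<Rightarrow> 'a \<Rightarrow> 'a"  (infixr \<open>*\<^sub>C\<close> 75)
  assumes scaleC_add_right: "a *\<^sub>C (x + y) = a *\<^sub>C x + a *\<^sub>C y"
    and scaleC_add_left: "(a + b) *\<^sub>C x = a *\<^sub>C x + b *\<^sub>C x"
    and scaleC_scaleC: "a *\<^sub>C b *\<^sub>C x = (a * b) *\<^sub>C x"
    and scaleC_one: "1 *\<^sub>C x = x"

global_interpretation complex_vector: vector_space "scaleC :: complex \<Rightarrow> 'a \<Rightarrow> 'a::complex_vector"
  by unfold_locales (simp_all add: scaleC_add_right scaleC_add_left scaleC_scaleC scaleC_one)

abbreviation clinear :: "('a::complex_vector \<Rightarrow> 'b::complex_vector) \<Rightarrow> bool" where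
  "clinear f \<equiv> Vector_Spaces.linear scaleC scaleC f"

definition cbilinear :: "('a::complex_vector \<Rightarrow> 'b::complex_vector \<Rightarrow> 'c::complex_vector) \<Rightarrow> bool" where
  "cbilinear f \<longleftrightarrow> (\<forall>x. clinear (\<lambda>y. f x y)) \<and> (\<forall>y. clinear (\<lambda>x. f x y))"

lemma clinear_iff:
  "clinear f \<longleftrightarrow> (\<forall>x y. f (x + y) = f x + f y) \<and> (\<forall>c x. f (c *\<^sub>C x) = c *\<^sub>C f x)"
  by (simp add: Vector_Spaces.linear_iff complex_vector.vector_space_axioms)

text \<open>The free complex vector space on a set of generators consists of the finitely supported
  complex-valued functions on that set.  The tensor product is the quotient of the free space on
  all pairs by the subspace spanned by the bilinearity relations.\<close>

definition free_scale :: "complex \<Rightarrow> ('g \<Rightarrow>\<^sub>0 complex) \<Rightarrow> ('g \<Rightarrow>\<^sub>0 complex)" where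
  "free_scale c p = Poly_Mapping.map ((*) c) p"

lemma lookup_free_scale: "Poly_Mapping.lookup (free_scale c p) k = c * Poly_Mapping.lookup p k"
  by (simp add: free_scale_def Poly_Mapping.map.rep_eq when_def)

global_interpretation free: vector_space "free_scale :: complex \<Rightarrow> ('g \<Rightarrow>\<^sub>0 complex) \<Rightarrow> _"
  by unfold_locales
    (auto intro!: poly_mapping_eqI simp: lookup_free_scale lookup_add algebra_simps)

abbreviation gen :: "'a \<Rightarrow> 'b \<Rightarrow> ('a \<times> 'b) \<Rightarrow>\<^sub>0 complex" where
  "gen x y \<equiv> Poly_Mapping.single (x, y) 1"

definition tensor_relations ::
    "(('a::complex_vector \<times> 'b::complex_vector) \<Rightarrow>\<^sub>0 complex) set" where
  "tensor_relations =
     {gen (x + x') y - gen x y - gen x' y | x x' y. True} \<union>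
     {gen x (y + y') - gen x y - gen x y' | x y y'. True} \<union>
     {gen (c *\<^sub>C x) y - free_scale c (gen x y) | c x y. True} \<union>
     {gen x (c *\<^sub>C y) - free_scale c (gen x y) | c x y. True}"

definition tensor_rel ::
    "(('a::complex_vector \<times> 'b::complex_vector) \<Rightarrow>\<^sub>0 complex) \<Rightarrow> (('a \<times> 'b) \<Rightarrow>\<^sub>0 complex) \<Rightarrow> bool" where
  "tensor_rel p q \<longleftrightarrow> p - q \<in> free.span tensor_relations"

lemma equivp_tensor_rel: "equivp tensor_rel"
proof (rule equivpI)
  show "reflp tensor_rel"
    by (auto simp: reflp_def tensor_rel_def free.span_zero)
  show "symp tensor_rel"
    by (auto simp: symp_def tensor_rel_def dest: free.span_neg)
  show "transp tensor_rel"
    by (auto simp: transp_def tensor_rel_def dest: free.span_add)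
qed

quotient_type (overloaded) ('a, 'b) tensor =
    "('a::complex_vector \<times> 'b::complex_vector) \<Rightarrow>\<^sub>0 complex" / tensor_rel
  by (rule equivp_tensor_rel)

instantiation tensor :: (complex_vector, complex_vector) complex_vector
begin

lift_definition zero_tensor :: "('a, 'b) tensor" is 0 .

lift_definition plus_tensor :: "('a, 'b) tensor \<Rightarrow> ('a, 'b) tensor \<Rightarrow> ('a, 'b) tensor" is "(+)"
  unfolding tensor_rel_def by (drule (1) free.span_add) (simp add: algebra_simps)

lift_definition uminus_tensor :: "('a, 'b) tensor \<Rightarrow> ('a, 'b) tensor" is uminus
  unfolding tensor_rel_def by (drule free.span_neg) (simp add: algebra_simps)

lift_definition minus_tensor :: "('a, 'b) tensor \<Rightarrow> ('a, 'b) tensor \<Rightarrow> ('a, 'b) tensor" is "(-)"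
  unfolding tensor_rel_def by (drule (1) free.span_diff) (simp add: algebra_simps)

lift_definition scaleC_tensor :: "complex \<Rightarrow> ('a, 'b) tensor \<Rightarrow> ('a, 'b) tensor" is free_scale
  unfolding tensor_rel_def
  by (metis free.span_scale free.scale_right_diff_distrib)

instance
  by standard
    (transfer; simp add: tensor_rel_def algebra_simps free.span_zero
       free.scale_right_distrib free.scale_left_distrib)+

end

lift_definition pure_tensor ::
    "'a::complex_vector \<Rightarrow> 'b::complex_vector \<Rightarrow> ('a, 'b) tensor"  (infixr \<open>\<otimes>\<close> 72)
  is gen .

lemma cbilinear_pure_tensor: "cbilinear (\<otimes>)"
proof -
  have rel: "r \<in> free.span tensor_relations"
    if "r \<in> tensor_relations" for r :: "('a \<times> 'b) \<Rightarrow>\<^sub>0 complex"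
    using that by (rule free.span_base)
  have "(x + x') \<otimes> y = x \<otimes> y + x' \<otimes> y" for x x' :: 'a and y :: 'b
    by transfer (unfold tensor_rel_def diff_diff_eq[symmetric], rule rel, unfold tensor_relations_def, blast)
  moreover have "x \<otimes> (y + y') = x \<otimes> y + x \<otimes> y'" for x :: 'a and y y' :: 'b
    by transfer (unfold tensor_rel_def diff_diff_eq[symmetric], rule rel, unfold tensor_relations_def, blast)
  moreover have "(c *\<^sub>C x) \<otimes> y = c *\<^sub>C (x \<otimes> y)" for c and x :: 'a and y :: 'b
    by transfer (unfold tensor_rel_def, rule rel, unfold tensor_relations_def, blast)
  moreover have "x \<otimes> (c *\<^sub>C y) = c *\<^sub>C (x \<otimes> y)" for c and x :: 'a and y :: 'b
    by transfer (unfold tensor_rel_def, rule rel, unfold tensor_relations_def, blast)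
  ultimately show ?thesis
    by (simp add: cbilinear_def clinear_iff)
qed

lemma free_eq_sum:
  "(p :: 'g \<Rightarrow>\<^sub>0 complex) = (\<Sum>k\<in>Poly_Mapping.keys p. free_scale (Poly_Mapping.lookup p k) (Poly_Mapping.single k 1))"
  by (rule poly_mapping_eqI)
    (simp add: lookup_sum lookup_free_scale lookup_single when_def in_keys_iff if_distrib
      cong: if_cong)

lemma span_gen: "free.span (range (\<lambda>(x, y). gen x y)) = (UNIV :: (('a \<times> 'b) \<Rightarrow>\<^sub>0 complex) set)"
proof -
  have "p \<in> free.span (range (\<lambda>(x, y). gen x y))" for p :: "('a \<times> 'b) \<Rightarrow>\<^sub>0 complex"
    by (subst free_eq_sum) (rule free.span_sum, rule free.span_scale, rule free.span_base, auto)
  then show ?thesis by blast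
qed

lemma span_pure_tensor:
  "complex_vector.span (range (\<lambda>(x, y). x \<otimes> y)) = (UNIV :: ('a::complex_vector, 'b::complex_vector) tensor set)"
proof -
  have "abs_tensor p \<in> complex_vector.span (range (\<lambda>(x, y). x \<otimes> y))"
    for p :: "('a \<times> 'b) \<Rightarrow>\<^sub>0 complex"
  proof -
    have "p \<in> free.span (range (\<lambda>(x, y). gen x y))" by (simp only: span_gen UNIV_I)
    then show ?thesis
    proof (induction rule: free.span_induct_alt)
      case base
      then show ?case by (simp add: zero_tensor_def[symmetric] complex_vector.span_zero)
    next
      case (step c g q)
      then obtain x y where "g = gen x y" by auto
      then have "abs_tensor (free_scale c g + q) = c *\<^sub>C (x \<otimes> y) + abs_tensor q"
        by (simp add: plus_tensor.abs_eq scaleC_tensor.abs_eq pure_tensor.abs_eq)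
      then show ?case
        using step(2) complex_vector.span_base[of "x \<otimes> y" "range (\<lambda>(x, y). x \<otimes> y)"]
        by (auto intro: complex_vector.span_add complex_vector.span_scale)
    qed
  qed
  then show ?thesis by (metis (no_types) Quotient_abs_rep Quotient_tensor UNIV_eq_I)
qed

lemma clinear_eq_on_pure_tensors:
  fixes g h :: "('a::complex_vector, 'b::complex_vector) tensor \<Rightarrow> 'c::complex_vector"
  assumes "clinear g" "clinear h" "\<And>x y. g (x \<otimes> y) = h (x \<otimes> y)"
  shows "g = h"
proof
  fix t :: "('a, 'b) tensor"
  have "t \<in> complex_vector.span (range (\<lambda>(x, y). x \<otimes> y))" by (simp add: span_pure_tensor)
  then show "g t = h t"
  proof (induction rule: complex_vector.span_induct_alt)
    case base
    have "clinear k \<Longrightarrow> k 0 = 0" for k :: "('a, 'b) tensor \<Rightarrow> 'c"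
      unfolding clinear_iff by (metis add_cancel_right_left)
    then show ?case using assms by metis
  next
    case (step c u v)
    then show ?case using assms by (auto simp: clinear_iff)
  qed
qed

theorem tensor_universal:
  fixes f :: "'a::complex_vector \<Rightarrow> 'b::complex_vector \<Rightarrow> 'c::complex_vector"
  assumes "cbilinear f"
  shows "\<exists>!g. clinear g \<and> (\<forall>x y. g (x \<otimes> y) = f x y)"
proof -
  define F where "F p = (\<Sum>k\<in>Poly_Mapping.keys p. Poly_Mapping.lookup p k *\<^sub>C case_prod f k)"
    for p :: "('a \<times> 'b) \<Rightarrow>\<^sub>0 complex"
  have F_eq: "F p = (\<Sum>k\<in>A. Poly_Mapping.lookup p k *\<^sub>C case_prod f k)"
    if "finite A" "Poly_Mapping.keys p \<subseteq> A" for p A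
    unfolding F_def by (rule sum.mono_neutral_left) (use that in \<open>auto simp: in_keys_iff\<close>)
  have F_add: "F (p + q) = F p + F q" for p q
  proof -
    let ?A = "Poly_Mapping.keys p \<union> Poly_Mapping.keys q"
    have "Poly_Mapping.keys (p + q) \<subseteq> ?A" by (rule Poly_Mapping.keys_add)
    then show ?thesis
      by (subst (1 2 3) F_eq[of ?A])
        (auto simp: lookup_add scaleC_add_left sum.distrib)
  qed
  have F_scale: "F (free_scale c p) = c *\<^sub>C F p" for c p
    by (subst (1 2) F_eq[of "Poly_Mapping.keys p"])
      (auto simp: in_keys_iff lookup_free_scale complex_vector.scale_sum_right)
  have F_diff: "F (p - q) = F p - F q" for p q
    using F_add[of "p - q" q] by simp
  have F_gen: "F (gen x y) = f x y" for x y
    by (simp add: F_def)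
  have f: "f (x + x') y = f x y + f x' y" "f x (y + y') = f x y + f x y'"
    "f (c *\<^sub>C x) y = c *\<^sub>C f x y" "f x (c *\<^sub>C y) = c *\<^sub>C f x y" for x x' y y' c
    using assms by (auto simp: cbilinear_def clinear_iff)
  have F_rel: "F p = 0" if "p \<in> free.span tensor_relations" for p
    using that
  proof (induction rule: free.span_induct_alt)
    case base
    then show ?case by (simp add: F_def)
  next
    case (step c r q)
    have "F r = 0"
      using step(1) by (auto simp: tensor_relations_def F_diff F_scale F_gen f)
    then show ?case using step by (simp add: F_add F_scale)
  qed
  define G where "G t = F (rep_tensor t)" for t
  have G_abs: "G (abs_tensor p) = F p" for p
  proof -
    have "tensor_rel (rep_tensor (abs_tensor p)) p"
      by (metis Quotient_rep_abs Quotient_tensor equivp_reflp equivp_tensor_rel)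
    then show ?thesis
      using F_rel F_diff unfolding G_def tensor_rel_def by (metis eq_iff_diff_eq_0)
  qed
  have abs_ex: "\<exists>p. t = abs_tensor p" for t :: "('a, 'b) tensor"
    by (metis Quotient_abs_rep Quotient_tensor)
  have "G (s + t) = G s + G t" for s t
    using abs_ex[of s] abs_ex[of t] by (auto simp: plus_tensor.abs_eq G_abs F_add)
  moreover have "G (c *\<^sub>C t) = c *\<^sub>C G t" for c t
    using abs_ex[of t] by (auto simp: scaleC_tensor.abs_eq G_abs F_scale)
  ultimately have "clinear G" by (simp add: clinear_iff)
  moreover have "G (x \<otimes> y) = f x y" for x y
    by (simp add: pure_tensor.abs_eq G_abs F_gen)
  ultimately show ?thesis
    using clinear_eq_on_pure_tensors by (metis (mono_tags, lifting))
qed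

text \<open>All algebras are over the complex numbers and need not be unital; the underlying vector
  space is the whole type.\<close>

definition novikov_algebra :: "complex \<Rightarrow> ('a::complex_vector \<Rightarrow> 'a \<Rightarrow> 'a) \<Rightarrow> bool" where
  "novikov_algebra \<delta> circ \<longleftrightarrow>
     cbilinear circ \<and>
     (\<forall>x y z. \<delta> *\<^sub>C circ (circ x y) z - circ x (circ y z)
              = \<delta> *\<^sub>C circ (circ y x) z - circ y (circ x z)) \<and>
     (\<forall>x y z. circ (circ x y) z = circ (circ x z) y)"

definition comm_assoc_algebra :: "('a::complex_vector \<Rightarrow> 'a \<Rightarrow> 'a) \<Rightarrow> bool" where
  "comm_assoc_algebra dot \<longleftrightarrow>
     cbilinear dot \<and>
     (\<forall>x y. dot x y = dot y x) \<and>
     (\<forall>x y z. dot (dot x y) z = dot x (dot y z))"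

definition novikov_poisson_algebra ::
    "complex \<Rightarrow> ('a::complex_vector \<Rightarrow> 'a \<Rightarrow> 'a) \<Rightarrow> ('a \<Rightarrow> 'a \<Rightarrow> 'a) \<Rightarrow> bool" where
  "novikov_poisson_algebra \<delta> dot circ \<longleftrightarrow>
     comm_assoc_algebra dot \<and>
     novikov_algebra \<delta> circ \<and>
     (\<forall>x y z. circ (dot x y) z = dot x (circ y z)) \<and>
     (\<forall>x y z. \<delta> *\<^sub>C dot (circ x y) z - circ x (dot y z)
              = \<delta> *\<^sub>C dot (circ y x) z - circ y (dot x z))"

definition is_tensor_dot ::
    "('a::complex_vector \<Rightarrow> 'a \<Rightarrow> 'a) \<Rightarrow> ('b::complex_vector \<Rightarrow> 'b \<Rightarrow> 'b) \<Rightarrow>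
     (('a, 'b) tensor \<Rightarrow> ('a, 'b) tensor \<Rightarrow> ('a, 'b) tensor) \<Rightarrow> bool" where
  "is_tensor_dot dot1 dot2 dot \<longleftrightarrow>
     cbilinear dot \<and>
     (\<forall>x1 x2 y1 y2. dot (x1 \<otimes> x2) (y1 \<otimes> y2) = dot1 x1 y1 \<otimes> dot2 x2 y2)"

definition is_tensor_circ ::
    "('a::complex_vector \<Rightarrow> 'a \<Rightarrow> 'a) \<Rightarrow> ('a \<Rightarrow> 'a \<Rightarrow> 'a) \<Rightarrow>
     ('b::complex_vector \<Rightarrow> 'b \<Rightarrow> 'b) \<Rightarrow> ('b \<Rightarrow> 'b \<Rightarrow> 'b) \<Rightarrow>
     (('a, 'b) tensor \<Rightarrow> ('a, 'b) tensor \<Rightarrow> ('a, 'b) tensor) \<Rightarrow> bool" where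
  "is_tensor_circ dot1 circ1 dot2 circ2 circ \<longleftrightarrow>
     cbilinear circ \<and>
     (\<forall>x1 x2 y1 y2. circ (x1 \<otimes> x2) (y1 \<otimes> y2)
        = circ1 x1 y1 \<otimes> dot2 x2 y2 + dot1 x1 y1 \<otimes> circ2 x2 y2)"

end

theory Submission
  imports Defs
begin

text \<open>
  A multilinear identity between tensors holds as soon as it holds for pure tensors, so every axiom
  reduces to a computation with \<open>X = x1 \<otimes> x2\<close>, \<open>Y = y1 \<otimes> y2\<close>, \<open>Z = z1 \<otimes> z2\<close>. Write \<open>\<cdot>\<close> and \<open>\<circ>\<close> for
  the operations of both factors. As \<open>\<circ>\<close> acts on \<open>N1 \<otimes> N2\<close> like a derivation, on one factor at a
  time, an expression with two operations \<open>\<circ>\<close> expands into four terms: two pure ones, in which both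
  operations fall on the same factor and the other factor contributes the fully symmetric product
  \<open>x \<cdot> y \<cdot> z\<close>, and two mixed ones. The pure terms are handled by the Novikov identities of the two
  factors.

  The mixed terms are controlled by the compatibility \<open>(x \<cdot> y) \<circ> z = x \<cdot> (y \<circ> z)\<close>. Together with
  commutativity it says that \<open>x \<cdot> (y \<circ> z)\<close> is symmetric in \<open>x\<close> and \<open>y\<close>. For right commutativity this
  identifies each mixed term of \<open>(X \<circ> Y) \<circ> Z\<close> with the other mixed term of \<open>(X \<circ> Z) \<circ> Y\<close>. For the left
  identity it turns the mixed terms of \<open>\<delta> (X \<circ> Y) \<circ> Z - X \<circ> (Y \<circ> Z)\<close> into the sum of
  \<open>(\<delta> (x1 \<circ> y1) \<cdot> z1 - x1 \<circ> (y1 \<cdot> z1)) \<otimes> ((x2 \<cdot> y2) \<circ> z2)\<close> and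
  \<open>((x1 \<cdot> y1) \<circ> z1) \<otimes> (\<delta> (x2 \<circ> y2) \<cdot> z2 - x2 \<circ> (y2 \<cdot> z2))\<close>. Both are symmetric under the exchange of
  \<open>x\<close> and \<open>y\<close>, by the second compatibility axiom of one factor and the symmetry above in the other.

  The two compatibility axioms of the tensor product contain \<open>\<circ>\<close> only once in each term, so they
  split into two summands, each of which is the same axiom in one factor.
\<close>

section \<open>Multilinear maps on tensor products\<close>

lemma cbilinear_iff:
  "cbilinear f \<longleftrightarrow>
     (\<forall>x x' y. f (x + x') y = f x y + f x' y) \<and> (\<forall>c x y. f (c *\<^sub>C x) y = c *\<^sub>C f x y) \<and>
     (\<forall>x y y'. f x (y + y') = f x y + f x y') \<and> (\<forall>c x y. f x (c *\<^sub>C y) = c *\<^sub>C f x y)"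
  unfolding cbilinear_def clinear_iff by blast

lemma cbilinear_diff:
  assumes "cbilinear f"
  shows "f (x - x') y = f x y - f x' y" "f x (y - y') = f x y - f x y'"
  using assms unfolding cbilinear_iff by (metis add_diff_cancel diff_add_cancel)+

lemmas pure_tensor_linear =
  cbilinear_pure_tensor[unfolded cbilinear_iff, THEN conjunct1, rule_format]
  cbilinear_pure_tensor[unfolded cbilinear_iff, THEN conjunct2, THEN conjunct1, rule_format]
  cbilinear_pure_tensor[unfolded cbilinear_iff, THEN conjunct2, THEN conjunct2, THEN conjunct1,
    rule_format]
  cbilinear_pure_tensor[unfolded cbilinear_iff, THEN conjunct2, THEN conjunct2, THEN conjunct2,
    rule_format]
  cbilinear_diff[OF cbilinear_pure_tensor]

lemma cbilinear_eq_on_pure_tensors: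
  fixes F G :: "('a::complex_vector, 'b::complex_vector) tensor \<Rightarrow>
      ('c::complex_vector, 'd::complex_vector) tensor \<Rightarrow> 'e::complex_vector"
  assumes F: "cbilinear F" and G: "cbilinear G"
    and eq: "\<And>x1 x2 y1 y2. F (x1 \<otimes> x2) (y1 \<otimes> y2) = G (x1 \<otimes> x2) (y1 \<otimes> y2)"
  shows "F = G"
proof (intro ext)
  fix X Y
  have "F (x1 \<otimes> x2) = G (x1 \<otimes> x2)" for x1 x2
    by (rule clinear_eq_on_pure_tensors) (use F G eq in \<open>auto simp: cbilinear_def\<close>)
  then have "(\<lambda>X. F X Y) = (\<lambda>X. G X Y)"
    by (intro clinear_eq_on_pure_tensors) (use F G in \<open>auto simp: cbilinear_def\<close>)
  then show "F X Y = G X Y" by meson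
qed

text \<open>Linearity in the first argument is kept apart from bilinearity in the other two, because that is
  the form in which the bilinear case and the linear case combine to the trilinear one.\<close>

definition ctrilinear ::
    "('a::complex_vector \<Rightarrow> 'b::complex_vector \<Rightarrow> 'c::complex_vector \<Rightarrow> 'd::complex_vector) \<Rightarrow> bool" where
  "ctrilinear F \<longleftrightarrow> (\<forall>X. cbilinear (F X)) \<and> (\<forall>Y Z. clinear (\<lambda>X. F X Y Z))"

lemma ctrilinear_eq_on_pure_tensors:
  fixes F G :: "('a::complex_vector, 'b::complex_vector) tensor \<Rightarrow>
      ('c::complex_vector, 'd::complex_vector) tensor \<Rightarrow>
      ('e::complex_vector, 'f::complex_vector) tensor \<Rightarrow> 'g::complex_vector"
  assumes F: "ctrilinear F" and G: "ctrilinear G"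
    and eq: "\<And>x1 x2 y1 y2 z1 z2.
      F (x1 \<otimes> x2) (y1 \<otimes> y2) (z1 \<otimes> z2) = G (x1 \<otimes> x2) (y1 \<otimes> y2) (z1 \<otimes> z2)"
  shows "F X Y Z = G X Y Z"
proof -
  have "F (x1 \<otimes> x2) = G (x1 \<otimes> x2)" for x1 x2
    by (rule cbilinear_eq_on_pure_tensors) (use F G eq in \<open>auto simp: ctrilinear_def\<close>)
  then have "(\<lambda>X. F X Y Z) = (\<lambda>X. G X Y Z)"
    by (intro clinear_eq_on_pure_tensors) (use F G in \<open>auto simp: ctrilinear_def\<close>)
  then show ?thesis by meson
qed

text \<open>Both sides of every axiom in three variables are built from these bracketings.\<close>

lemma ctrilinear_nested:
  assumes "cbilinear f" "cbilinear g"
  shows "ctrilinear (\<lambda>x y z. f (g x y) z)" "ctrilinear (\<lambda>x y z. f (g x z) y)"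
    "ctrilinear (\<lambda>x y z. f (g y x) z)"
    "ctrilinear (\<lambda>x y z. f x (g y z))" "ctrilinear (\<lambda>x y z. f y (g x z))"
  using assms by (simp_all add: ctrilinear_def cbilinear_iff clinear_iff)

lemma ctrilinear_scale_diff:
  assumes "ctrilinear F" "ctrilinear G"
  shows "ctrilinear (\<lambda>x y z. c *\<^sub>C F x y z - G x y z)"
  using assms
  by (simp add: ctrilinear_def cbilinear_iff clinear_iff scaleC_add_right scaleC_scaleC
      complex_vector.scale_right_diff_distrib mult.commute algebra_simps)

text \<open>The universal property of the tensor product, used in one tensor argument at a time: the
  uniqueness part for the second argument makes the extension linear in the parameters \<open>x1\<close>, \<open>x2\<close> of
  the first one, and the universal property then applies again.\<close>

lemma ex1_cbilinear_extension:
  fixes f :: "'a::complex_vector \<Rightarrow> 'b::complex_vector \<Rightarrow>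
      'c::complex_vector \<Rightarrow> 'd::complex_vector \<Rightarrow> 'e::complex_vector"
  assumes first: "\<And>y1 y2. cbilinear (\<lambda>x1 x2. f x1 x2 y1 y2)"
    and second: "\<And>x1 x2. cbilinear (f x1 x2)"
  shows "\<exists>!B. cbilinear B \<and> (\<forall>x1 x2 y1 y2. B (x1 \<otimes> x2) (y1 \<otimes> y2) = f x1 x2 y1 y2)"
proof -
  have "\<exists>g. \<forall>x1 x2. clinear (g x1 x2) \<and> (\<forall>y1 y2. g x1 x2 (y1 \<otimes> y2) = f x1 x2 y1 y2)"
    using ex1_implies_ex[OF tensor_universal[OF second]] by metis
  then obtain g where g_lin: "\<And>x1 x2. clinear (g x1 x2)"
    and g: "\<And>x1 x2 y1 y2. g x1 x2 (y1 \<otimes> y2) = f x1 x2 y1 y2"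
    by blast
  have g_add1: "g (x1 + x1') x2 = (\<lambda>Y. g x1 x2 Y + g x1' x2 Y)" for x1 x1' x2
    by (rule clinear_eq_on_pure_tensors)
      (use g_lin first in \<open>auto simp: g clinear_iff cbilinear_iff scaleC_add_right algebra_simps\<close>)
  have g_add2: "g x1 (x2 + x2') = (\<lambda>Y. g x1 x2 Y + g x1 x2' Y)" for x1 x2 x2'
    by (rule clinear_eq_on_pure_tensors)
      (use g_lin first in \<open>auto simp: g clinear_iff cbilinear_iff scaleC_add_right algebra_simps\<close>)
  have g_scale1: "g (c *\<^sub>C x1) x2 = (\<lambda>Y. c *\<^sub>C g x1 x2 Y)" for c x1 x2
    by (rule clinear_eq_on_pure_tensors)
      (use g_lin first in \<open>auto simp: g clinear_iff cbilinear_iff scaleC_add_right scaleC_scaleC mult.commute\<close>)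
  have g_scale2: "g x1 (c *\<^sub>C x2) = (\<lambda>Y. c *\<^sub>C g x1 x2 Y)" for c x1 x2
    by (rule clinear_eq_on_pure_tensors)
      (use g_lin first in \<open>auto simp: g clinear_iff cbilinear_iff scaleC_add_right scaleC_scaleC mult.commute\<close>)
  have g_bil: "cbilinear (\<lambda>x1 x2. g x1 x2 Y)" for Y
    by (simp add: cbilinear_iff g_add1 g_add2 g_scale1 g_scale2)
  have "\<exists>B. \<forall>Y. clinear (B Y) \<and> (\<forall>x1 x2. B Y (x1 \<otimes> x2) = g x1 x2 Y)"
    using ex1_implies_ex[OF tensor_universal[OF g_bil]] by metis
  then obtain B where B_lin: "\<And>Y. clinear (B Y)"
    and B: "\<And>Y x1 x2. B Y (x1 \<otimes> x2) = g x1 x2 Y"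
    by blast
  have B_add: "B (Y + Y') = (\<lambda>X. B Y X + B Y' X)" for Y Y'
    by (rule clinear_eq_on_pure_tensors)
      (use B_lin g_lin in \<open>auto simp: B clinear_iff scaleC_add_right algebra_simps\<close>)
  have B_scale: "B (c *\<^sub>C Y) = (\<lambda>X. c *\<^sub>C B Y X)" for c Y
    by (rule clinear_eq_on_pure_tensors)
      (use B_lin g_lin in \<open>auto simp: B clinear_iff scaleC_add_right scaleC_scaleC mult.commute\<close>)
  have "cbilinear (\<lambda>X Y. B Y X)"
    using B_lin by (simp add: cbilinear_def clinear_iff B_add B_scale)
  then show ?thesis
    by (intro ex1I[of _ "\<lambda>X Y. B Y X"] cbilinear_eq_on_pure_tensors conjI) (auto simp: B g)
qed

section \<open>The tensor product of two delta-Novikov--Poisson algebras\<close>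

lemma ex1_tensor_dot:
  assumes "cbilinear dot1" "cbilinear dot2"
  shows "\<exists>!dot. is_tensor_dot dot1 dot2 dot"
  unfolding is_tensor_dot_def
  by (rule ex1_cbilinear_extension)
    (use assms in \<open>auto simp: cbilinear_iff pure_tensor_linear\<close>)

lemma ex1_tensor_circ:
  assumes "cbilinear dot1" "cbilinear circ1" "cbilinear dot2" "cbilinear circ2"
  shows "\<exists>!circ. is_tensor_circ dot1 circ1 dot2 circ2 circ"
  unfolding is_tensor_circ_def
  by (rule ex1_cbilinear_extension)
    (use assms in \<open>auto simp: cbilinear_iff pure_tensor_linear scaleC_add_right algebra_simps\<close>)

lemma novikov_poisson_algebraD:
  assumes "novikov_poisson_algebra \<delta> dot circ"
  shows "cbilinear dot" "cbilinear circ"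
    "dot x y = dot y x" "dot (dot x y) z = dot x (dot y z)"
    "\<delta> *\<^sub>C circ (circ x y) z - circ x (circ y z) = \<delta> *\<^sub>C circ (circ y x) z - circ y (circ x z)"
    "circ (circ x y) z = circ (circ x z) y"
    "circ (dot x y) z = dot x (circ y z)"
    "\<delta> *\<^sub>C dot (circ x y) z - circ x (dot y z) = \<delta> *\<^sub>C dot (circ y x) z - circ y (dot x z)"
  using assms
  unfolding novikov_poisson_algebra_def comm_assoc_algebra_def novikov_algebra_def by blast+

lemma comm_assoc_algebra_tensor:
  assumes "comm_assoc_algebra dot1" "comm_assoc_algebra dot2"
    and "is_tensor_dot dot1 dot2 dot"
  shows "comm_assoc_algebra dot"
proof -
  note fac = assms(1,2)[unfolded comm_assoc_algebra_def]
  have bil: "cbilinear dot" and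
    pure: "dot (x1 \<otimes> x2) (y1 \<otimes> y2) = dot1 x1 y1 \<otimes> dot2 x2 y2" for x1 x2 y1 y2
    using assms(3) by (auto simp: is_tensor_dot_def)
  have "dot = (\<lambda>X Y. dot Y X)"
    by (rule cbilinear_eq_on_pure_tensors)
      (use bil fac in \<open>auto simp: cbilinear_def pure\<close>)
  then have "dot X Y = dot Y X" for X Y by meson
  moreover have "dot (dot X Y) Z = dot X (dot Y Z)" for X Y Z
    by (rule ctrilinear_eq_on_pure_tensors[OF
        ctrilinear_nested(1)[OF bil bil] ctrilinear_nested(4)[OF bil bil]])
      (simp add: pure fac[THEN conjunct2, THEN conjunct2, rule_format])
  ultimately show ?thesis
    using bil by (simp add: comm_assoc_algebra_def)
qed

lemma novikov_poisson_algebra_tensor: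
  fixes dot1 circ1 :: "'a::complex_vector \<Rightarrow> 'a \<Rightarrow> 'a"
    and dot2 circ2 :: "'b::complex_vector \<Rightarrow> 'b \<Rightarrow> 'b"
  assumes N1: "novikov_poisson_algebra \<delta> dot1 circ1"
    and N2: "novikov_poisson_algebra \<delta> dot2 circ2"
    and dot: "is_tensor_dot dot1 dot2 dot"
    and circ: "is_tensor_circ dot1 circ1 dot2 circ2 circ"
  shows "novikov_poisson_algebra \<delta> dot circ"
proof -
  note np1 = novikov_poisson_algebraD[OF N1] and np2 = novikov_poisson_algebraD[OF N2]
  have bil: "cbilinear dot" "cbilinear circ" using dot circ
    by (auto simp: is_tensor_dot_def is_tensor_circ_def)
  have pure:
    "dot (x1 \<otimes> x2) (y1 \<otimes> y2) = dot1 x1 y1 \<otimes> dot2 x2 y2"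
    "circ (x1 \<otimes> x2) (y1 \<otimes> y2) = circ1 x1 y1 \<otimes> dot2 x2 y2 + dot1 x1 y1 \<otimes> circ2 x2 y2"
    for x1 x2 y1 y2
    using dot circ by (auto simp: is_tensor_dot_def is_tensor_circ_def)
  have add:
    "dot (X + X') Y = dot X Y + dot X' Y" "dot X (Y + Y') = dot X Y + dot X Y'"
    "circ (X + X') Y = circ X Y + circ X' Y" "circ X (Y + Y') = circ X Y + circ X Y'"
    for X X' Y Y'
    using bil by (auto simp: cbilinear_iff)

  \<comment> \<open>Consequences of the first compatibility axiom and commutativity; they control the mixed terms.\<close>
  have sym1: "dot1 x (circ1 y z) = dot1 y (circ1 x z)" for x y z
    using np1(3,7) by metis
  have sym2: "dot2 x (circ2 y z) = dot2 y (circ2 x z)" for x y z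
    using np2(3,7) by metis
  have swap1: "dot1 (circ1 x y) z = dot1 x (circ1 z y)" for x y z
    using np1(3) sym1 by metis
  have swap2: "dot2 (circ2 x y) z = dot2 x (circ2 z y)" for x y z
    using np2(3) sym2 by metis
  have perm1: "dot1 x (dot1 y z) = dot1 y (dot1 x z)" for x y z
    using np1(3,4) by metis
  have perm2: "dot2 x (dot2 y z) = dot2 y (dot2 x z)" for x y z
    using np2(3,4) by metis

  have right_comm: "circ (circ X Y) Z = circ (circ X Z) Y" for X Y Z
  proof (rule ctrilinear_eq_on_pure_tensors[OF
        ctrilinear_nested(1)[OF bil(2,2)] ctrilinear_nested(2)[OF bil(2,2)]])
    fix x1 y1 z1 :: 'a and x2 y2 z2 :: 'b
    show "circ (circ (x1 \<otimes> x2) (y1 \<otimes> y2)) (z1 \<otimes> z2) = circ (circ (x1 \<otimes> x2) (z1 \<otimes> z2)) (y1 \<otimes> y2)"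
      by (simp add: pure add np1(4,7) np2(4,7) swap1 swap2
          np1(3)[of y1 z1] np2(3)[of y2 z2] np1(6)[of x1 y1 z1] np2(6)[of x2 y2 z2])
  qed

  \<comment> \<open>The left-hand sides of the left Novikov identity and of the second compatibility axiom in each
    factor, kept folded so that each axiom becomes a symmetry in the first two arguments.\<close>
  define L1 where "L1 x y z = \<delta> *\<^sub>C circ1 (circ1 x y) z - circ1 x (circ1 y z)" for x y z
  define L2 where "L2 x y z = \<delta> *\<^sub>C circ2 (circ2 x y) z - circ2 x (circ2 y z)" for x y z
  define P1 where "P1 x y z = \<delta> *\<^sub>C dot1 (circ1 x y) z - circ1 x (dot1 y z)" for x y z
  define P2 where "P2 x y z = \<delta> *\<^sub>C dot2 (circ2 x y) z - circ2 x (dot2 y z)" for x y z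
  have LP_sym: "L1 x y z = L1 y x z" "P1 x y z = P1 y x z"
    "L2 x' y' z' = L2 y' x' z'" "P2 x' y' z' = P2 y' x' z'" for x y z x' y' z'
    unfolding L1_def L2_def P1_def P2_def by (rule np1(5) np1(8) np2(5) np2(8))+

  have left: "\<delta> *\<^sub>C circ (circ X Y) Z - circ X (circ Y Z)
      = \<delta> *\<^sub>C circ (circ Y X) Z - circ Y (circ X Z)" for X Y Z
  proof (rule ctrilinear_eq_on_pure_tensors[OF
        ctrilinear_scale_diff[OF ctrilinear_nested(1)[OF bil(2,2)] ctrilinear_nested(4)[OF bil(2,2)]]
        ctrilinear_scale_diff[OF ctrilinear_nested(3)[OF bil(2,2)] ctrilinear_nested(5)[OF bil(2,2)]]])
    \<comment> \<open>The mixed terms pair up because \<open>(x \<cdot> y) \<circ> z = x \<cdot> (y \<circ> z)\<close> gives the two tensors that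
      come from either bracketing a common factor.\<close>
    have expand: "\<delta> *\<^sub>C circ (circ (x1 \<otimes> x2) (y1 \<otimes> y2)) (z1 \<otimes> z2)
          - circ (x1 \<otimes> x2) (circ (y1 \<otimes> y2) (z1 \<otimes> z2))
        = L1 x1 y1 z1 \<otimes> dot2 x2 (dot2 y2 z2) + dot1 x1 (dot1 y1 z1) \<otimes> L2 x2 y2 z2
          + P1 x1 y1 z1 \<otimes> dot2 x2 (circ2 y2 z2) + dot1 x1 (circ1 y1 z1) \<otimes> P2 x2 y2 z2"
      for x1 y1 z1 x2 y2 z2
      by (simp add: pure add L1_def L2_def P1_def P2_def pure_tensor_linear np1(4,7) np2(4,7)
          scaleC_add_right)
    fix x1 y1 z1 :: 'a and x2 y2 z2 :: 'b
    show "\<delta> *\<^sub>C circ (circ (x1 \<otimes> x2) (y1 \<otimes> y2)) (z1 \<otimes> z2)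
          - circ (x1 \<otimes> x2) (circ (y1 \<otimes> y2) (z1 \<otimes> z2))
        = \<delta> *\<^sub>C circ (circ (y1 \<otimes> y2) (x1 \<otimes> x2)) (z1 \<otimes> z2)
          - circ (y1 \<otimes> y2) (circ (x1 \<otimes> x2) (z1 \<otimes> z2))"
      unfolding expand
      by (simp only: LP_sym(1,2)[of x1 y1 z1] LP_sym(3,4)[of x2 y2 z2]
          perm1[of x1 y1 z1] perm2[of x2 y2 z2] sym1[of x1 y1 z1] sym2[of x2 y2 z2])
  qed

  have compat: "circ (dot X Y) Z = dot X (circ Y Z)" for X Y Z
    by (rule ctrilinear_eq_on_pure_tensors[OF
        ctrilinear_nested(1)[OF bil(2,1)] ctrilinear_nested(4)[OF bil]])
      (simp add: pure add np1(4,7) np2(4,7))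

  have poisson: "\<delta> *\<^sub>C dot (circ X Y) Z - circ X (dot Y Z)
      = \<delta> *\<^sub>C dot (circ Y X) Z - circ Y (dot X Z)" for X Y Z
  proof (rule ctrilinear_eq_on_pure_tensors[OF
        ctrilinear_scale_diff[OF ctrilinear_nested(1)[OF bil] ctrilinear_nested(4)[OF bil(2,1)]]
        ctrilinear_scale_diff[OF ctrilinear_nested(3)[OF bil] ctrilinear_nested(5)[OF bil(2,1)]]])
    have expand: "\<delta> *\<^sub>C dot (circ (x1 \<otimes> x2) (y1 \<otimes> y2)) (z1 \<otimes> z2)
          - circ (x1 \<otimes> x2) (dot (y1 \<otimes> y2) (z1 \<otimes> z2))
        = P1 x1 y1 z1 \<otimes> dot2 x2 (dot2 y2 z2) + dot1 x1 (dot1 y1 z1) \<otimes> P2 x2 y2 z2"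
      for x1 y1 z1 x2 y2 z2
      by (simp add: pure add P1_def P2_def pure_tensor_linear np1(4) np2(4) scaleC_add_right)
    fix x1 y1 z1 :: 'a and x2 y2 z2 :: 'b
    show "\<delta> *\<^sub>C dot (circ (x1 \<otimes> x2) (y1 \<otimes> y2)) (z1 \<otimes> z2)
          - circ (x1 \<otimes> x2) (dot (y1 \<otimes> y2) (z1 \<otimes> z2))
        = \<delta> *\<^sub>C dot (circ (y1 \<otimes> y2) (x1 \<otimes> x2)) (z1 \<otimes> z2)
          - circ (y1 \<otimes> y2) (dot (x1 \<otimes> x2) (z1 \<otimes> z2))"
      unfolding expand
      by (simp only: LP_sym(1,2)[of x1 y1 z1] LP_sym(3,4)[of x2 y2 z2] perm1[of x1 y1 z1] perm2[of x2 y2 z2])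
  qed

  have "comm_assoc_algebra dot"
    using comm_assoc_algebra_tensor N1 N2 dot unfolding novikov_poisson_algebra_def by blast
  then show ?thesis
    unfolding novikov_poisson_algebra_def novikov_algebra_def
    using bil right_comm left compat poisson by blast
qed

theorem theorem28:
  fixes \<delta> :: complex
    and dot1 circ1 :: "'a::complex_vector \<Rightarrow> 'a \<Rightarrow> 'a"
    and dot2 circ2 :: "'b::complex_vector \<Rightarrow> 'b \<Rightarrow> 'b"
  assumes "novikov_poisson_algebra \<delta> dot1 circ1"
    and "novikov_poisson_algebra \<delta> dot2 circ2"
  shows "(\<exists>!dot. is_tensor_dot dot1 dot2 dot) \<and>
         (\<exists>!circ. is_tensor_circ dot1 circ1 dot2 circ2 circ) \<and>
         (\<forall>dot circ. is_tensor_dot dot1 dot2 dot \<and> is_tensor_circ dot1 circ1 dot2 circ2 circ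
            \<longrightarrow> novikov_poisson_algebra \<delta> dot circ)"
  using ex1_tensor_dot ex1_tensor_circ novikov_poisson_algebra_tensor[OF assms]
    novikov_poisson_algebraD(1,2)[OF assms(1)] novikov_poisson_algebraD(1,2)[OF assms(2)]
  by blast

end
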